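(* Let $G$ be an $n$-dimensional torus, let $\Gamma$ be a finite $d$-valent graph with vertex set $V$ equipped with a GKM action of $G$ with edge weights $\alpha_e$, let $T\subset G$ be a circle subgroup not contained in any $G_e$, let $f\in K_G(\Gamma)$ and $p\in V$, and let $$f_p^{\#}=f_p\prod_{i(e)=p}(1-e^{2\pi i\alpha_e})^{-1}.$$ Then $\mathrm{Res}_T f_p^{\#}$ is an element of $R(G/T)$.
   Context: Torus notation. $\mathfrak g$ is the Lie algebra of $G$, $\mathbb Z_G=\ker(\exp:\mathfrak g\to G)$, and $\mathbb Z_G^*=\{\alpha\in\mathfrak g^*:\alpha(v)\in\mathbb Z\text{ for all }v\in\mathbb Z_G\}$ is the weight lattice. For $\alpha\in\mathbb Z_G^*$, $e^{2\pi i\alpha}:G\to S^1$ is the character $\exp(x)\mapsto e^{2\pi i\alpha(x)}$. For a compact commutative Lie group $H$, $R(H)$ is the representation ring, identified with the character ring: all finite sums $\sum m_k\chi_k$ with $m_k\in\mathbb Z$ and $\chi_k:H\to S^1$ characters. Graph and action. $E$ is the set of oriented edges of $\Gamma$ (each unoriented edge gives two oriented edges). For $e\in E$, $i(e)$ and $t(e)$ are its initial and terminal vertices and $\bar e$ is $e$ with reversed orientation. $d$-valent means each vertex $p$ has exactly $d$ oriented edges $e$ with $i(e)=p$. An action of $G$ on $\Gamma$ assigns to each $e\in E$ a one-dimensional representation $\varrho_e$ with character $\chi_e=e^{2\pi i\alpha_e}$, $\alpha_e\in\mathbb Z_G^*$, and to each $p\in V$ a $d$-dimensional representation $\tau_p$,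 such that, with $G_e=\ker\chi_e$: $\tau_p\simeq\bigoplus_{i(e)=p}\varrho_e$ for all $p$; $\varrho_{\bar e}\simeq\varrho_e^*$ (so $\alpha_{\bar e}=-\alpha_e$); and $\tau_{i(e)}|_{G_e}\simeq\tau_{t(e)}|_{G_e}$ for all $e$. The action is GKM if for any two distinct oriented edges $e_1\ne e_2$ with $i(e_1)=i(e_2)$ the weights $\alpha_{e_1},\alpha_{e_2}$ are linearly independent. $K_G(\Gamma)$ is the set of functions $f:V\to R(G)$, $p\mapsto f_p$, with $r_e f_{i(e)}=r_e f_{t(e)}$ for every edge $e$, where $r_e:R(G)\to R(G_e)$ is restriction. Residue. Let $\xi$ be a basis vector of $\mathbb Z_T=\ker(\exp:\mathfrak t\to T)$ (the infinitesimal generator of $T$); identify $T$ with $S^1$ by $\exp(s\xi)\leftrightarrow e^{2\pi is}$, and hence $T^{\mathbb C}$ with $\mathbb C\setminus\{0\}$. Characters extend so that $e^{2\pi i\alpha}(gz)=e^{2\pi i\alpha}(g)\,z^{\alpha(\xi)}$ for $g\in G$, $z\in\mathbb C\setminus\{0\}$. For fixed $g\in G$, $z\mapsto f_p^{\#}(gz)$ is meromorphic on $\mathbb C\setminus\{0\}$ with poles on the unit circle. Define $$(\mathrm{Res}_T f_p^{\#})(g)=\frac1{2\pi i}\int_{C_+}f_p^{\#}(gz)\frac{dz}{z}-\frac1{2\pi i}\int_{C_-}f_p^{\#}(gz)\frac{dz}{z},$$ where $C_+$, $C_-$ are circles centered at $0$ of radius greater than one and less than one respectively, both oriented counter-clockwise.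 This function of $g$ is $T$-invariant and so is regarded as a function on $G/T$; the claim is that this function is an element of the character ring $R(G/T)$. *)

theory Defs
  imports
    "HOL-Complex_Analysis.Complex_Analysis"
    "HOL-Algebra.Coset"
    "Jordan_Normal_Form.Matrix"
    "Graph_Theory.Bidirected_Digraph"
begin

text \<open>
  A topological group is given by a group \<open>H\<close> together with a topology \<open>X\<close> whose underlying set is
  \<open>carrier H\<close>. Functions on \<open>H\<close> are functions on the type of elements; only their values on
  \<open>carrier H\<close> matter.
\<close>

section \<open>Characters and the character ring\<close>

definition circle_group :: "complex monoid" where
  "circle_group = \<lparr>carrier = sphere 0 1, monoid.mult = (*), one = 1\<rparr>"

definition group_character :: "('g, 'm) monoid_scheme \<Rightarrow> 'g topology \<Rightarrow> ('g \<Rightarrow> complex) \<Rightarrow> bool" where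
  "group_character H X c \<longleftrightarrow> c \<in> hom H circle_group \<and> continuous_map X euclidean c"

definition character_ring :: "('g, 'm) monoid_scheme \<Rightarrow> 'g topology \<Rightarrow> ('g \<Rightarrow> complex) set" where
  "character_ring H X =
    {f. \<exists>S m. finite S \<and> (\<forall>c\<in>S. group_character H X c) \<and>
          (\<forall>h\<in>carrier H. f h = (\<Sum>c\<in>S. of_int (m c) * c h))}"

section \<open>Complex matrix representations\<close>

definition representation ::
  "('g, 'm) monoid_scheme \<Rightarrow> 'g topology \<Rightarrow> nat \<Rightarrow> ('g \<Rightarrow> complex mat) \<Rightarrow> bool" where
  "representation H X d \<rho> \<longleftrightarrow>
    (\<forall>h\<in>carrier H. \<rho> h \<in> carrier_mat d d) \<and>
    \<rho> \<one>\<^bsub>H\<^esub> = 1\<^sub>m d \<and>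
    (\<forall>g\<in>carrier H. \<forall>h\<in>carrier H. \<rho> (g \<otimes>\<^bsub>H\<^esub> h) = \<rho> g * \<rho> h) \<and>
    (\<forall>i<d. \<forall>j<d. continuous_map X euclidean (\<lambda>h. \<rho> h $$ (i, j)))"

definition rep_iso ::
  "('g, 'm) monoid_scheme \<Rightarrow> nat \<Rightarrow> ('g \<Rightarrow> complex mat) \<Rightarrow> ('g \<Rightarrow> complex mat) \<Rightarrow> bool" where
  "rep_iso H d \<rho> \<sigma> \<longleftrightarrow>
    (\<exists>P\<in>carrier_mat d d. invertible_mat P \<and> (\<forall>h\<in>carrier H. P * \<rho> h = \<sigma> h * P))"

definition dual_rep :: "('g, 'm) monoid_scheme \<Rightarrow> ('g \<Rightarrow> complex mat) \<Rightarrow> 'g \<Rightarrow> complex mat" where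
  "dual_rep H \<rho> h = transpose_mat (\<rho> (inv\<^bsub>H\<^esub> h))"

section \<open>Tori\<close>

text \<open>
  An \<open>n\<close>-dimensional torus, with \<open>n = DIM('v)\<close>: the type \<open>'v\<close> is the Lie algebra, \<open>ex\<close> is the
  exponential map, and \<open>G\<close> is the quotient, as a topological group, of \<open>'v\<close> by the kernel of
  \<open>ex\<close>, which is a lattice of full rank. The inner product of \<open>'v\<close> plays no role.
\<close>

definition integral_lattice :: "('g, 'm) monoid_scheme \<Rightarrow> ('v::euclidean_space \<Rightarrow> 'g) \<Rightarrow> 'v set" where
  "integral_lattice G ex = {v. ex v = \<one>\<^bsub>G\<^esub>}"

locale torus = comm_group G
  for G :: "('g, 'm) monoid_scheme" (structure)
  and X :: "'g topology"
  and ex :: "'v::euclidean_space \<Rightarrow> 'g" +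
  assumes topspace_eq: "topspace X = carrier G"
    and exp_quotient: "quotient_map euclidean X ex"
    and exp_add: "ex (x + y) = ex x \<otimes> ex y"
    and kernel_lattice: "\<exists>B. independent B \<and> span B = UNIV \<and>
          integral_lattice G ex = {\<Sum>b\<in>B. of_int (m b) *\<^sub>R b |m :: 'v \<Rightarrow> int. True}"

definition weight_lattice ::
  "('g, 'm) monoid_scheme \<Rightarrow> ('v::euclidean_space \<Rightarrow> 'g) \<Rightarrow> ('v \<Rightarrow>\<^sub>L real) set" where
  "weight_lattice G ex = {\<alpha>. \<forall>v\<in>integral_lattice G ex. blinfun_apply \<alpha> v \<in> \<int>}"

text \<open>
  The character \<open>ex x \<mapsto> e\<^sup>2\<^sup>\<pi>\<^sup>i\<^sup>\<alpha>\<^sup>(\<^sup>x\<^sup>)\<close>. It does not depend on the chosen preimage when \<open>\<alpha>\<close> lies in the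
  weight lattice.
\<close>

definition weight_char :: "('v::euclidean_space \<Rightarrow> 'g) \<Rightarrow> ('v \<Rightarrow>\<^sub>L real) \<Rightarrow> 'g \<Rightarrow> complex" where
  "weight_char ex \<alpha> g = exp (2 * of_real pi * \<i> * of_real (blinfun_apply \<alpha> (inv_into UNIV ex g)))"

definition circle_subgroup :: "('g, 'm) monoid_scheme \<Rightarrow> 'g topology \<Rightarrow> 'g set \<Rightarrow> bool" where
  "circle_subgroup G X T \<longleftrightarrow> subgroup T G \<and>
    (\<exists>\<phi>. \<phi> \<in> iso circle_group (G\<lparr>carrier := T\<rparr>) \<and>
         homeomorphic_map (top_of_set (sphere 0 1)) (subtopology X T) \<phi>)"

definition lie_subalgebra :: "('v::euclidean_space \<Rightarrow> 'g) \<Rightarrow> 'g set \<Rightarrow> 'v set" where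
  "lie_subalgebra ex T = {x. \<forall>s::real. ex (s *\<^sub>R x) \<in> T}"

definition infinitesimal_generator ::
  "('g, 'm) monoid_scheme \<Rightarrow> ('v::euclidean_space \<Rightarrow> 'g) \<Rightarrow> 'g set \<Rightarrow> 'v \<Rightarrow> bool" where
  "infinitesimal_generator G ex T \<xi> \<longleftrightarrow> \<xi> \<noteq> 0 \<and>
    integral_lattice G ex \<inter> lie_subalgebra ex T = range (\<lambda>k::int. of_int k *\<^sub>R \<xi>)"

text \<open>The quotient topology on the set of cosets.\<close>

definition quotient_group_topology ::
  "('g, 'm) monoid_scheme \<Rightarrow> 'g topology \<Rightarrow> 'g set \<Rightarrow> 'g set topology" where
  "quotient_group_topology G X T =
    topology (\<lambda>U. U \<subseteq> carrier (G Mod T) \<and> openin X {g \<in> topspace X. T #>\<^bsub>G\<^esub> g \<in> U})"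

lemma quotient_map_coset:
  assumes "topspace X = carrier G"
  shows "quotient_map X (quotient_group_topology G X T) (\<lambda>g. T #>\<^bsub>G\<^esub> g)"
proof -
  let ?P = "\<lambda>U. U \<subseteq> carrier (G Mod T) \<and> openin X {g \<in> topspace X. T #>\<^bsub>G\<^esub> g \<in> U}"
  have int: "?P (U \<inter> V)" if "?P U" "?P V" for U V
  proof -
    have "{g \<in> topspace X. T #>\<^bsub>G\<^esub> g \<in> U \<inter> V} =
      {g \<in> topspace X. T #>\<^bsub>G\<^esub> g \<in> U} \<inter> {g \<in> topspace X. T #>\<^bsub>G\<^esub> g \<in> V}" by auto
    with that show ?thesis by auto
  qed
  have un: "?P (\<Union>K)" if "\<forall>U\<in>K. ?P U" for K
  proof -
    have "{g \<in> topspace X. T #>\<^bsub>G\<^esub> g \<in> \<Union>K} = (\<Union>U\<in>K. {g \<in> topspace X. T #>\<^bsub>G\<^esub> g \<in> U})"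
      by auto
    with that show ?thesis by auto
  qed
  have "istopology ?P"
    unfolding istopology_def using int un by blast
  hence op: "openin (quotient_group_topology G X T) = ?P"
    by (simp add: quotient_group_topology_def topology_inverse')
  have car: "carrier (G Mod T) = (\<lambda>g. T #>\<^bsub>G\<^esub> g) ` topspace X"
    by (auto simp: FactGroup_def RCOSETS_def assms)
  have "{g \<in> topspace X. T #>\<^bsub>G\<^esub> g \<in> carrier (G Mod T)} = topspace X"
    using car by auto
  hence "?P (carrier (G Mod T))" by simp
  hence top: "topspace (quotient_group_topology G X T) = carrier (G Mod T)"
    unfolding topspace_def op by blast
  show ?thesis
    unfolding quotient_map_def top op using car by auto
qed

section \<open>Torus actions on graphs\<close>

definition edge_kernel ::
  "('g, 'm) monoid_scheme \<Rightarrow> ('v::euclidean_space \<Rightarrow> 'g) \<Rightarrow> ('v \<Rightarrow>\<^sub>L real) \<Rightarrow> 'g set" where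
  "edge_kernel G ex \<alpha> = kernel G circle_group (weight_char ex \<alpha>)"

text \<open>
  The arcs of \<open>\<Gamma>\<close> are the oriented edges, \<open>tail\<close> and \<open>head\<close> are the initial and terminal vertex,
  and \<open>rev\<close> reverses the orientation. The direct sum of the \<open>\<rho> e\<close> is formed along an enumeration of
  the outgoing edges, whose order is irrelevant up to isomorphism.
\<close>

locale torus_graph_action =
  torus G X ex + graph: bidirected_digraph \<Gamma> rev + graph: fin_digraph \<Gamma>
  for G :: "('g, 'm) monoid_scheme" (structure)
  and X :: "'g topology"
  and ex :: "'v::euclidean_space \<Rightarrow> 'g"
  and \<Gamma> :: "('p, 'e) pre_digraph"
  and rev :: "'e \<Rightarrow> 'e" +
  fixes d :: nat
    and \<rho> :: "'e \<Rightarrow> 'g \<Rightarrow> complex mat"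
    and \<tau> :: "'p \<Rightarrow> 'g \<Rightarrow> complex mat"
    and \<alpha> :: "'e \<Rightarrow> 'v \<Rightarrow>\<^sub>L real"
  assumes valent: "p \<in> verts \<Gamma> \<Longrightarrow> out_degree \<Gamma> p = d"
    and edge_rep: "e \<in> arcs \<Gamma> \<Longrightarrow> representation G X 1 (\<rho> e)"
    and edge_weight: "e \<in> arcs \<Gamma> \<Longrightarrow> \<alpha> e \<in> weight_lattice G ex"
    and edge_char: "\<lbrakk>e \<in> arcs \<Gamma>; g \<in> carrier G\<rbrakk> \<Longrightarrow> \<rho> e g $$ (0, 0) = weight_char ex (\<alpha> e) g"
    and vertex_rep: "p \<in> verts \<Gamma> \<Longrightarrow> representation G X d (\<tau> p)"
    and vertex_sum: "p \<in> verts \<Gamma> \<Longrightarrow> \<exists>es. distinct es \<and> set es = out_arcs \<Gamma> p \<and>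
          rep_iso G d (\<tau> p) (\<lambda>g. diag_block_mat (map (\<lambda>e. \<rho> e g) es))"
    and edge_rev: "e \<in> arcs \<Gamma> \<Longrightarrow> rep_iso G 1 (\<rho> (rev e)) (dual_rep G (\<rho> e))"
    and edge_restrict: "e \<in> arcs \<Gamma> \<Longrightarrow>
          rep_iso (G\<lparr>carrier := edge_kernel G ex (\<alpha> e)\<rparr>) d (\<tau> (tail \<Gamma> e)) (\<tau> (head \<Gamma> e))"

locale gkm_action = torus_graph_action +
  assumes gkm: "\<lbrakk>e\<^sub>1 \<in> arcs \<Gamma>; e\<^sub>2 \<in> arcs \<Gamma>; e\<^sub>1 \<noteq> e\<^sub>2; tail \<Gamma> e\<^sub>1 = tail \<Gamma> e\<^sub>2\<rbrakk> \<Longrightarrow>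
          \<alpha> e\<^sub>1 \<noteq> \<alpha> e\<^sub>2 \<and> independent {\<alpha> e\<^sub>1, \<alpha> e\<^sub>2}"

definition graph_K_ring ::
  "('g, 'm) monoid_scheme \<Rightarrow> 'g topology \<Rightarrow> ('v::euclidean_space \<Rightarrow> 'g) \<Rightarrow>
   ('p, 'e) pre_digraph \<Rightarrow> ('e \<Rightarrow> 'v \<Rightarrow>\<^sub>L real) \<Rightarrow> ('p \<Rightarrow> 'g \<Rightarrow> complex) set" where
  "graph_K_ring G X ex \<Gamma> \<alpha> =
    {f \<in> verts \<Gamma> \<rightarrow> character_ring G X. \<forall>e\<in>arcs \<Gamma>.
       restrict (f (tail \<Gamma> e)) (edge_kernel G ex (\<alpha> e)) =
       restrict (f (head \<Gamma> e)) (edge_kernel G ex (\<alpha> e))}"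

section \<open>Extension to the complexification and the residue\<close>

text \<open>
  The value of the extended character at \<open>g z\<close>, for \<open>g\<close> in \<open>G\<close> and \<open>z \<noteq> 0\<close> in the complexification
  of \<open>T\<close>. For \<open>\<alpha>\<close> in the weight lattice, \<open>\<alpha> \<xi>\<close> is an integer, so the floor only converts the type.
\<close>

definition ext_char ::
  "('v::euclidean_space \<Rightarrow> 'g) \<Rightarrow> 'v \<Rightarrow> ('v \<Rightarrow>\<^sub>L real) \<Rightarrow> 'g \<Rightarrow> complex \<Rightarrow> complex" where
  "ext_char ex \<xi> \<alpha> g z = weight_char ex \<alpha> g * z powi \<lfloor>blinfun_apply \<alpha> \<xi>\<rfloor>"

text \<open>
  The multiplicities \<open>m\<close> in \<open>f = \<Sum>\<alpha>. m \<alpha> e\<^sup>2\<^sup>\<pi>\<^sup>i\<^sup>\<alpha>\<close>. They exist for every \<open>f\<close> in \<open>R(G)\<close>, since all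
  characters of a torus come from weights, and they are unique, since distinct characters of a
  group are linearly independent; so the choice operator involves no choice.
\<close>

definition weight_multiplicities ::
  "('g, 'm) monoid_scheme \<Rightarrow> ('v::euclidean_space \<Rightarrow> 'g) \<Rightarrow> ('g \<Rightarrow> complex) \<Rightarrow> ('v \<Rightarrow>\<^sub>L real) \<Rightarrow> int" where
  "weight_multiplicities G ex f =
    (SOME m. finite {\<alpha>. m \<alpha> \<noteq> 0} \<and> {\<alpha>. m \<alpha> \<noteq> 0} \<subseteq> weight_lattice G ex \<and>
       (\<forall>g\<in>carrier G. f g = (\<Sum>\<alpha> | m \<alpha> \<noteq> 0. of_int (m \<alpha>) * weight_char ex \<alpha> g)))"

definition ext_fun ::
  "('g, 'm) monoid_scheme \<Rightarrow> ('v::euclidean_space \<Rightarrow> 'g) \<Rightarrow> 'v \<Rightarrow> ('g \<Rightarrow> complex) \<Rightarrow> 'g \<Rightarrow> complex \<Rightarrow> complex"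
  where
  "ext_fun G ex \<xi> f g z =
    (let m = weight_multiplicities G ex f
     in \<Sum>\<alpha> | m \<alpha> \<noteq> 0. of_int (m \<alpha>) * ext_char ex \<xi> \<alpha> g z)"

text \<open>The value of \<open>f\<^sub>p\<^sup>#\<close> at \<open>g z\<close>.\<close>

definition f_sharp ::
  "('g, 'm) monoid_scheme \<Rightarrow> ('v::euclidean_space \<Rightarrow> 'g) \<Rightarrow> ('p, 'e) pre_digraph \<Rightarrow>
   ('e \<Rightarrow> 'v \<Rightarrow>\<^sub>L real) \<Rightarrow> 'v \<Rightarrow> ('p \<Rightarrow> 'g \<Rightarrow> complex) \<Rightarrow> 'p \<Rightarrow> 'g \<Rightarrow> complex \<Rightarrow> complex" where
  "f_sharp G ex \<Gamma> \<alpha> \<xi> f p g z =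
    ext_fun G ex \<xi> (f p) g z * (\<Prod>e\<in>out_arcs \<Gamma> p. inverse (1 - ext_char ex \<xi> (\<alpha> e) g z))"

text \<open>
  The residue of \<open>F (g z) dz / z\<close>, with \<open>R > 1\<close> and \<open>0 < r < 1\<close> the radii of the two circles.
\<close>

definition residue_T :: "real \<Rightarrow> real \<Rightarrow> ('g \<Rightarrow> complex \<Rightarrow> complex) \<Rightarrow> 'g \<Rightarrow> complex" where
  "residue_T R r F g =
    1 / (2 * of_real pi * \<i>) * contour_integral (circlepath 0 R) (\<lambda>z. F g z / z) -
    1 / (2 * of_real pi * \<i>) * contour_integral (circlepath 0 r) (\<lambda>z. F g z / z)"

end

theory Submission
  imports Defs
begin

text \<open>
  Each of the two integrals in \<open>Res\<^sub>T f\<^sub>p\<^sup>#\<close> is separately an element of \<open>R(G/T)\<close>. Expand \<open>f\<^sub>p\<close> into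
  characters. On a circle of radius less than one, after replacing \<open>\<alpha>\<^sub>e\<close> by its opposite where
  \<open>\<alpha>\<^sub>e(\<xi>) < 0\<close>, repeated use of \<open>1 / (1 - w) = 1 + w / (1 - w)\<close> either removes a factor or raises the
  exponent of \<open>z\<close> in the numerator; once that exponent is positive the integral vanishes by Cauchy's
  theorem. What remains is a finite integer combination of characters of \<open>G\<close> whose weights vanish
  on \<open>\<xi>\<close>, that is, of characters trivial on \<open>T\<close>. The outer circle reduces to the inner one by
  \<open>z \<mapsto> 1 / z\<close>, which replaces \<open>\<xi>\<close> by \<open>- \<xi>\<close>.
\<close>

section \<open>Continuous homomorphisms into the circle\<close>

text \<open>Additivity alone gives homogeneity for rational scalars. Both sides are continuous in
  \<open>s\<close>, so density of the rationals in the reals does the rest.\<close>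

lemma continuous_additive_scaleR:
  fixes a :: "'v::real_normed_vector \<Rightarrow> real"
  assumes cont: "continuous_on UNIV a" and add: "\<And>x y. a (x + y) = a x + a y"
  shows "a (s *\<^sub>R x) = s * a x"
proof -
  have a0: "a 0 = 0" using add[of 0 0] by simp
  have neg: "a (- x) = - a x" for x using add[of x "- x"] a0 by simp
  have nat: "a (real n *\<^sub>R x) = real n * a x" for n x
    by (induction n) (simp_all add: a0 add algebra_simps)
  have int: "a (real_of_int k *\<^sub>R x) = real_of_int k * a x" for k x
  proof (cases "k \<ge> 0")
    case True
    then show ?thesis using nat[of "nat k" x] by simp
  next
    case False
    then show ?thesis using nat[of "nat (- k)" "- x"] by (simp add: neg)
  qed
  have rat: "a (q *\<^sub>R x) - q * a x = 0" if "q \<in> \<rat>" for q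
  proof -
    from that obtain m n where mn: "n > 0" "q = real_of_int m / real n"
      unfolding Rats_eq_int_div_nat by auto
    have "real n * a (q *\<^sub>R x) = a (real n *\<^sub>R (q *\<^sub>R x))" by (simp only: nat)
    also have "real n *\<^sub>R (q *\<^sub>R x) = real_of_int m *\<^sub>R x" using mn by simp
    finally have "real n * a (q *\<^sub>R x) = real n * (q * a x)" using mn by (simp add: int)
    then show ?thesis using mn(1) by simp
  qed
  have "a (s *\<^sub>R x) - s * a x = 0"
  proof (rule continuous_constant_on_closure[where S = "\<rat>" and f = "\<lambda>s. a (s *\<^sub>R x) - s * a x"])
    show "continuous_on (closure \<rat>) (\<lambda>s. a (s *\<^sub>R x) - s * a x)"
      by (intro continuous_intros continuous_on_compose2[OF cont]) auto
    show "s \<in> closure \<rat>" by (simp add: Rats_closure_real)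
  qed (use rat in auto)
  then show ?thesis by simp
qed

text \<open>A vector space is contractible, so \<open>h\<close> has a continuous logarithm. The
  logarithm can fail to be additive only by multiples of 2 pi i, and a continuous defect with such
  values is constant. Since \<open>h\<close> has modulus one, the logarithm is purely imaginary, and
  its rescaled imaginary part is the functional sought. It is applied to the Lie algebra and to the
  real line.\<close>

lemma continuous_hom_circle_exp:
  fixes h :: "'v::euclidean_space \<Rightarrow> complex"
  assumes cont: "continuous_on UNIV h"
    and mult: "\<And>x y. h (x + y) = h x * h y" and unit: "\<And>x. norm (h x) = 1"
  obtains \<alpha> :: "'v \<Rightarrow>\<^sub>L real"
    where "\<And>x. h x = exp (2 * of_real pi * \<i> * of_real (blinfun_apply \<alpha> x))"
proof -
  have nz: "h x \<noteq> 0" for x using unit[of x] by auto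
  obtain l where l: "continuous_on UNIV l" "\<And>x. h x = exp (l x)"
    using continuous_logarithm_on_contractible[OF cont contractible_UNIV] nz by auto
  have h0: "h 0 = 1" using mult[of 0 0] nz[of 0] by simp
  \<comment> \<open>Normalised to \<open>L 0 = 0\<close>; as \<open>h 0 = 1\<close>, this keeps it a
    logarithm of \<open>h\<close>.\<close>
  define L where "L x = l x - l 0" for x
  have contL: "continuous_on UNIV L" unfolding L_def using l(1) by (intro continuous_intros)
  have expL: "exp (L x) = h x" for x
    using l(2) h0 by (simp add: L_def exp_diff)
  have addL: "L (x + y) = L x + L y" for x y
  proof -
    \<comment> \<open>The defect of additivity for fixed \<open>y\<close>. Once known to be constant
      it equals \<open>D 0 = - L 0 = 0\<close>.\<close>
    define D where "D x = L (x + y) - L x - L y" for x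
    have e1: "exp (D x) = 1" for x
      using mult nz by (simp add: D_def exp_diff expL)
    have "D constant_on UNIV"
    proof (rule continuous_discrete_range_constant)
      show "continuous_on UNIV D"
        unfolding D_def by (intro continuous_intros continuous_on_compose2[OF contL]) auto
      \<comment> \<open>Values of \<open>D\<close> lie in 2 pi i Z, so two distinct ones are at
        least 2 pi apart.\<close>
      show "\<exists>e>0. \<forall>y. y \<in> UNIV \<and> D y \<noteq> D x \<longrightarrow> e \<le> norm (D y - D x)" for x
      proof (intro exI conjI allI impI)
        fix y assume "y \<in> UNIV \<and> D y \<noteq> D x"
        moreover have "exp (D y - D x) = 1" by (simp add: exp_diff e1)
        then obtain n where n: "Re (D y - D x) = 0" "Im (D y - D x) = real_of_int (2 * n) * pi"
          by (auto simp: exp_eq_1)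
        ultimately have "n \<noteq> 0" by (auto simp: complex_eq_iff)
        then have "1 \<le> \<bar>real_of_int n\<bar>" by linarith
        then have "2 * pi \<le> \<bar>Im (D y - D x)\<bar>" unfolding n(2) by (simp add: abs_mult)
        then show "2 * pi \<le> norm (D y - D x)" using abs_Im_le_cmod order_trans by blast
      qed simp
    qed (simp add: connected_UNIV)
    then have "D x = D 0" unfolding constant_on_def by auto
    then show ?thesis by (simp add: D_def L_def algebra_simps)
  qed
  have re: "Re (L x) = 0" for x
    using unit[of x] by (simp flip: expL)
  define a where "a x = Im (L x) / (2 * pi)" for x
  have "bounded_linear a"
  proof -
    have adda: "a (x + y) = a x + a y" for x y by (simp add: a_def addL add_divide_distrib)
    have "continuous_on UNIV a"
      unfolding a_def by (intro continuous_intros contL) auto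
    from continuous_additive_scaleR[OF this adda] adda show ?thesis
      by (intro linear_conv_bounded_linear[THEN iffD1] linearI) auto
  qed
  then have "blinfun_apply (Blinfun a) x = a x" for x by (simp add: bounded_linear_Blinfun_apply)
  moreover have "h x = exp (2 * of_real pi * \<i> * of_real (a x))" for x
  proof -
    have "2 * of_real pi * \<i> * of_real (a x) = L x"
      by (simp add: complex_eq_iff re a_def)
    then show ?thesis by (simp add: expL)
  qed
  ultimately show ?thesis using that[of "Blinfun a"] by auto
qed

section \<open>Circle means\<close>

text \<open>The normalised contour integral of \<open>F z / z\<close>, since \<open>dz / z\<close>
  is 2 pi i dt on the circle. As an integral over the parameter it makes linearity and the
  substitution z = 1 / w facts about integrals over the unit interval.\<close>

definition circle_mean :: "real \<Rightarrow> (complex \<Rightarrow> complex) \<Rightarrow> complex" where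
  "circle_mean r F = integral {0..1} (\<lambda>t. F (circlepath 0 r t))"

lemma contour_integral_eq_circle_mean:
  assumes "r \<noteq> 0"
  shows "1 / (2 * of_real pi * \<i>) * contour_integral (circlepath 0 r) (\<lambda>z. F z / z) = circle_mean r F"
proof -
  have "contour_integral (circlepath 0 r) (\<lambda>z. F z / z) =
      integral {0..1} (\<lambda>t. 2 * of_real pi * \<i> * F (circlepath 0 r t))"
    unfolding contour_integral_integral
    by (intro arg_cong2[where f = integral] ext refl)
       (use assms in \<open>simp only: vector_derivative_circlepath, simp add: circlepath field_simps\<close>)
  then show ?thesis by (simp add: circle_mean_def)
qed

lemma circlepath_integrable:
  fixes F :: "complex \<Rightarrow> complex"
  assumes "continuous_on (sphere 0 r) F" "r \<ge> 0"
  shows "(\<lambda>t. F (circlepath 0 r t)) integrable_on {0..1}"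
proof (rule integrable_continuous_real)
  have "continuous_on {0..1} (circlepath 0 r)"
    using path_circlepath path_def by blast
  moreover have "circlepath 0 r ` {0..1} \<subseteq> sphere 0 r"
    using assms(2) path_image_circlepath[of 0 r] by (simp add: path_image_def)
  ultimately show "continuous_on {0..1} (\<lambda>t. F (circlepath 0 r t))"
    using continuous_on_compose2[OF assms(1)] by blast
qed

lemma circle_mean_add:
  assumes "continuous_on (sphere 0 r) F" "continuous_on (sphere 0 r) H" "r \<ge> 0"
  shows "circle_mean r (\<lambda>z. F z + H z) = circle_mean r F + circle_mean r H"
  unfolding circle_mean_def
  by (intro integral_add circlepath_integrable assms)

lemma circle_mean_cmult: "circle_mean r (\<lambda>z. c * F z) = c * circle_mean r F"
  unfolding circle_mean_def by simp

lemma circle_mean_const: "circle_mean r (\<lambda>z. c) = c"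
  unfolding circle_mean_def by simp

lemma circle_mean_sum:
  assumes "finite S" "\<And>s. s \<in> S \<Longrightarrow> continuous_on (sphere 0 r) (F s)" "r \<ge> 0"
  shows "circle_mean r (\<lambda>z. \<Sum>s\<in>S. F s z) = (\<Sum>s\<in>S. circle_mean r (F s))"
  unfolding circle_mean_def
  by (intro integral_sum circlepath_integrable assms)

lemma circle_mean_cong:
  assumes "\<And>z. norm z = r \<Longrightarrow> F z = H z" "r \<ge> 0"
  shows "circle_mean r F = circle_mean r H"
  unfolding circle_mean_def
  by (intro integral_cong assms(1)) (use assms(2) in \<open>simp add: circlepath norm_mult\<close>)

text \<open>Reversing the parameter, t to 1 - t, conjugates the point on the unit circle, and
  \<open>R\<close> times that conjugate is the inverse of the point of radius \<open>1 / R\<close>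
  at parameter t. The mean is taken with respect to dt, so no sign appears.\<close>

lemma circle_mean_inverse:
  assumes "continuous_on (sphere 0 R) F" "R > 0"
  shows "circle_mean R F = circle_mean (1 / R) (\<lambda>w. F (inverse w))"
proof -
  have "((\<lambda>t. F (circlepath 0 R t)) has_integral circle_mean R F) {0..1}"
    unfolding circle_mean_def
    using circlepath_integrable[OF assms(1)] assms(2) by (simp add: integrable_integral)
  from has_integral_affinity[OF this[folded box_real], of "-1" 1]
  have "((\<lambda>t. F (circlepath 0 R (1 - t))) has_integral circle_mean R F)
      ((\<lambda>x. 1 - x) ` {0..1})" by simp
  also have "(\<lambda>x::real. 1 - x) ` {0..1} = {0..1}"
    by (auto simp: image_iff intro!: bexI[of _ "1 - _"])
  also have "(\<lambda>t. F (circlepath 0 R (1 - t))) = (\<lambda>t. F (inverse (circlepath 0 (1 / R) t)))"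
    using assms(2) by (simp add: circlepath right_diff_distrib exp_diff exp_two_pi_i field_simps)
  finally show ?thesis unfolding circle_mean_def by (metis integral_unique)
qed

text \<open>The factor \<open>z\<close> cancels the pole of \<open>dz / z\<close>, leaving a
  holomorphic integrand on a disc that contains the closed path: Cauchy's theorem applies.\<close>

lemma circle_mean_holomorphic:
  assumes "h holomorphic_on ball 0 s" "0 < r" "r < s"
  shows "circle_mean r (\<lambda>z. z * h z) = 0"
proof -
  have "contour_integral (circlepath 0 r) (\<lambda>z. z * h z / z) = contour_integral (circlepath 0 r) h"
    by (intro contour_integral_cong refl) (use assms in auto)
  also have "\<dots> = 0"
    by (intro contour_integral_unique Cauchy_theorem_convex_simple[OF assms(1)])
       (use assms in auto)
  finally show ?thesis
    using contour_integral_eq_circle_mean[of r "\<lambda>z. z * h z"] assms by simp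
qed

text \<open>Positive exponents vanish by Cauchy's theorem; inversion turns negative exponents into
  positive ones.\<close>

lemma circle_mean_powi:
  assumes "r > 0"
  shows "circle_mean r (\<lambda>z. z powi k) = (if k = 0 then 1 else 0)"
proof -
  have pos: "circle_mean r (\<lambda>z. z powi k) = 0" if "k > 0" "r > 0" for k r
  proof -
    have "circle_mean r (\<lambda>z. z powi k) = circle_mean r (\<lambda>z. z * z ^ nat (k - 1))"
      using that by (intro circle_mean_cong)
        (auto simp: power_int_def Suc_nat_eq_nat_zadd1 simp flip: power_Suc)
    also have "\<dots> = 0"
      using that by (intro circle_mean_holomorphic[of _ "r + 1"] holomorphic_intros) auto
    finally show ?thesis .
  qed
  show ?thesis
  proof (cases "k < 0")
    case True
    have "circle_mean r (\<lambda>z. z powi k) = circle_mean (1 / r) (\<lambda>z. inverse z powi k)"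
      using assms by (intro circle_mean_inverse continuous_intros) auto
    also have "\<dots> = circle_mean (1 / r) (\<lambda>z. z powi (- k))"
      by (simp add: power_int_minus power_int_inverse)
    finally show ?thesis using pos[of "-k" "1 / r"] True assms by simp
  next
    case False
    then show ?thesis using pos[of k r] assms by (auto simp: circle_mean_const)
  qed
qed

section \<open>The character ring\<close>

lemma character_ring_character:
  assumes "group_character H Y c"
  shows "c \<in> character_ring H Y"
proof -
  have "\<forall>h\<in>carrier H. c h = (\<Sum>c\<in>{c}. of_int ((\<lambda>_. 1) c) * c h)" by simp
  with assms show ?thesis
    unfolding character_ring_def by (intro CollectI exI[of _ "{c}"] exI[of _ "\<lambda>_. 1"]) auto
qed

lemma character_ring_zero: "(\<lambda>_. 0) \<in> character_ring H Y"
  unfolding character_ring_def by (auto intro!: exI[of _ "{}"])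

lemma character_ring_add:
  assumes "f \<in> character_ring H Y" "g \<in> character_ring H Y"
  shows "(\<lambda>h. f h + g h) \<in> character_ring H Y"
proof -
  obtain S m where S: "finite S" "\<forall>c\<in>S. group_character H Y c"
    "\<forall>h\<in>carrier H. f h = (\<Sum>c\<in>S. of_int (m c) * c h)"
    using assms(1) unfolding character_ring_def by blast
  obtain S' m' where S': "finite S'" "\<forall>c\<in>S'. group_character H Y c"
    "\<forall>h\<in>carrier H. g h = (\<Sum>c\<in>S'. of_int (m' c) * c h)"
    using assms(2) unfolding character_ring_def by blast
  \<comment> \<open>A character may occur in both expansions, so the coefficients are extended by
    zero and added.\<close>
  define k where "k c = (if c \<in> S then m c else 0) + (if c \<in> S' then m' c else 0)" for c
  have "f h + g h = (\<Sum>c\<in>S \<union> S'. of_int (k c) * c h)" if "h \<in> carrier H" for h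
  proof -
    have "f h = (\<Sum>c\<in>S \<union> S'. of_int (if c \<in> S then m c else 0) * c h)"
      using S(3) that by (auto intro!: sum.mono_neutral_cong_left S(1) S'(1))
    moreover have "g h = (\<Sum>c\<in>S \<union> S'. of_int (if c \<in> S' then m' c else 0) * c h)"
      using S'(3) that by (auto intro!: sum.mono_neutral_cong_left S(1) S'(1))
    ultimately show ?thesis
      by (simp add: k_def distrib_right flip: sum.distrib)
  qed
  with S(1,2) S'(1,2) show ?thesis
    unfolding character_ring_def by (intro CollectI exI[of _ "S \<union> S'"] exI[of _ k]) auto
qed

lemma character_ring_cmult:
  assumes "f \<in> character_ring H Y"
  shows "(\<lambda>h. of_int k * f h) \<in> character_ring H Y"
proof -
  obtain S m where S: "finite S" "\<forall>c\<in>S. group_character H Y c"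
    "\<forall>h\<in>carrier H. f h = (\<Sum>c\<in>S. of_int (m c) * c h)"
    using assms(1) unfolding character_ring_def by blast
  have "\<forall>h\<in>carrier H. of_int k * f h = (\<Sum>c\<in>S. of_int (k * m c) * c h)"
    using S(3) by (simp add: sum_distrib_left mult.assoc)
  with S(1,2) show ?thesis
    unfolding character_ring_def by (intro CollectI exI[of _ S] exI[of _ "\<lambda>c. k * m c"]) auto
qed

text \<open>The shape of the final claim, phrased for a function on \<open>G\<close>: it is the
  pullback of an element of the character ring of the quotient. The integrals can then be
  manipulated on \<open>G\<close> itself, using only closure under integer combinations.\<close>

definition descends ::
  "('g, 'm) monoid_scheme \<Rightarrow> 'g topology \<Rightarrow> 'g set \<Rightarrow> ('g \<Rightarrow> complex) \<Rightarrow> bool" where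
  "descends G X T F \<longleftrightarrow> (\<exists>\<phi>\<in>character_ring (G Mod T) (quotient_group_topology G X T).
    \<forall>g\<in>carrier G. \<phi> (T #>\<^bsub>G\<^esub> g) = F g)"

lemma descends_zero: "descends G X T (\<lambda>_. 0)"
  unfolding descends_def using character_ring_zero by fastforce

lemma descends_add:
  assumes "descends G X T F" "descends G X T F'"
  shows "descends G X T (\<lambda>g. F g + F' g)"
proof -
  from assms obtain \<phi> \<phi>' where
    "\<phi> \<in> character_ring (G Mod T) (quotient_group_topology G X T)"
    "\<phi>' \<in> character_ring (G Mod T) (quotient_group_topology G X T)"
    "\<forall>g\<in>carrier G. \<phi> (T #>\<^bsub>G\<^esub> g) = F g" "\<forall>g\<in>carrier G. \<phi>' (T #>\<^bsub>G\<^esub> g) = F' g"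
    unfolding descends_def by blast
  then show ?thesis
    unfolding descends_def by (intro bexI[of _ "\<lambda>h. \<phi> h + \<phi>' h"] character_ring_add) auto
qed

lemma descends_cmult:
  assumes "descends G X T F"
  shows "descends G X T (\<lambda>g. of_int k * F g)"
proof -
  from assms obtain \<phi> where
    "\<phi> \<in> character_ring (G Mod T) (quotient_group_topology G X T)"
    "\<forall>g\<in>carrier G. \<phi> (T #>\<^bsub>G\<^esub> g) = F g"
    unfolding descends_def by blast
  then show ?thesis
    unfolding descends_def by (intro bexI[of _ "\<lambda>h. of_int k * \<phi> h"] character_ring_cmult) auto
qed

lemma descends_diff:
  assumes "descends G X T F" "descends G X T F'"
  shows "descends G X T (\<lambda>g. F g - F' g)"
  using descends_add[OF assms(1) descends_cmult[OF assms(2), of "-1"]] by simp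

lemma descends_sum:
  assumes "finite S" "\<And>s. s \<in> S \<Longrightarrow> descends G X T (F s)"
  shows "descends G X T (\<lambda>g. \<Sum>s\<in>S. F s g)"
  using assms by (induction S) (simp_all add: descends_zero descends_add)

lemma descends_cong:
  assumes "descends G X T F" "\<And>g. g \<in> carrier G \<Longrightarrow> F g = F' g"
  shows "descends G X T F'"
  using assms unfolding descends_def by simp

section \<open>Weights and characters of a torus\<close>

lemma weight_char_add: "weight_char ex (\<alpha> + \<beta>) g = weight_char ex \<alpha> g * weight_char ex \<beta> g"
  by (simp add: weight_char_def blinfun.add_left ring_distribs exp_add)

lemma weight_char_minus: "weight_char ex (- \<alpha>) g = inverse (weight_char ex \<alpha> g)"
  by (simp add: weight_char_def blinfun.minus_left exp_minus)

lemma norm_weight_char: "norm (weight_char ex \<alpha> g) = 1"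
  by (simp add: weight_char_def)

lemma weight_lattice_add:
  "\<alpha> \<in> weight_lattice G ex \<Longrightarrow> \<beta> \<in> weight_lattice G ex \<Longrightarrow> \<alpha> + \<beta> \<in> weight_lattice G ex"
  by (auto simp: weight_lattice_def blinfun.add_left)

lemma weight_lattice_minus: "\<alpha> \<in> weight_lattice G ex \<Longrightarrow> - \<alpha> \<in> weight_lattice G ex"
  by (auto simp: weight_lattice_def blinfun.minus_left)

lemma weight_lattice_sum:
  assumes "\<And>s. s \<in> S \<Longrightarrow> \<alpha> s \<in> weight_lattice G ex"
  shows "(\<Sum>s\<in>S. \<alpha> s) \<in> weight_lattice G ex"
  using assms by (induction S rule: infinite_finite_induct)
    (auto intro: weight_lattice_add, auto simp: weight_lattice_def)

lemma exp_two_pi_Ints: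
  "exp (2 * of_real pi * \<i> * of_real a) = 1 \<longleftrightarrow> a \<in> \<int>"
proof -
  have "exp (2 * of_real pi * \<i> * of_real a) = 1 \<longleftrightarrow> (\<exists>n. a = real_of_int n)"
    by (auto simp: exp_eq_1)
  then show ?thesis by (auto elim: Ints_cases)
qed

section \<open>Characters of a torus as weights, and the circle \<open>T\<close> as an exponential
  line\<close>

context torus
begin

lemma ex_closed: "ex x \<in> carrier G"
  using exp_quotient topspace_eq by (auto simp: quotient_map_def)

lemma ex_inv_into: "g \<in> carrier G \<Longrightarrow> ex (inv_into UNIV ex g) = g"
  using exp_quotient topspace_eq by (auto simp: quotient_map_def intro!: f_inv_into_f)

lemma ex_0: "ex 0 = \<one>"
  using exp_add[of 0 0] ex_closed[of 0] by (metis add_0 l_cancel_one)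

lemma ex_eq_imp_diff: "ex x = ex y \<Longrightarrow> x - y \<in> integral_lattice G ex"
  using exp_add[of "x - y" y] ex_closed[of "x - y"] ex_closed[of y]
  by (simp add: integral_lattice_def)

text \<open>Two preimages under \<open>ex\<close> differ by a vector of the integral lattice, on
  which a weight is integral, so the preimage picked by \<open>inv_into\<close> may be replaced by
  any other.\<close>

lemma weight_char_exp:
  assumes "\<alpha> \<in> weight_lattice G ex"
  shows "weight_char ex \<alpha> (ex x) = exp (2 * of_real pi * \<i> * of_real (blinfun_apply \<alpha> x))"
proof -
  define y where "y = inv_into UNIV ex (ex x)"
  have "ex y = ex x" unfolding y_def by (simp add: f_inv_into_f)
  then have "blinfun_apply \<alpha> (y - x) \<in> \<int>"
    using assms ex_eq_imp_diff unfolding weight_lattice_def by blast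
  then have "exp (2 * of_real pi * \<i> * of_real (blinfun_apply \<alpha> (y - x))) = 1"
    by (simp only: exp_two_pi_Ints)
  then show ?thesis
    by (simp add: weight_char_def y_def[symmetric] blinfun.diff_right right_diff_distrib exp_diff)
qed

lemma weight_char_mult:
  assumes "\<alpha> \<in> weight_lattice G ex" "g \<in> carrier G" "h \<in> carrier G"
  shows "weight_char ex \<alpha> (g \<otimes> h) = weight_char ex \<alpha> g * weight_char ex \<alpha> h"
proof -
  obtain x y where "g = ex x" "h = ex y" using assms ex_inv_into by metis
  then show ?thesis
    by (simp add: weight_char_exp[OF assms(1)] blinfun.add_right ring_distribs
        Transcendental.exp_add flip: exp_add)
qed

text \<open>The chosen preimage need not vary continuously with the group element; continuity is
  tested after composing with the quotient map \<open>ex\<close> instead.\<close>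

lemma continuous_weight_char:
  assumes "\<alpha> \<in> weight_lattice G ex"
  shows "continuous_map X euclidean (weight_char ex \<alpha>)"
proof (rule continuous_compose_quotient_map[OF exp_quotient])
  have "weight_char ex \<alpha> \<circ> ex = (\<lambda>x. exp (2 * of_real pi * \<i> * of_real (blinfun_apply \<alpha> x)))"
    by (auto simp: weight_char_exp[OF assms])
  then show "continuous_map euclidean euclidean (weight_char ex \<alpha> \<circ> ex)"
    by (auto intro!: continuous_intros)
qed

text \<open>Pulled back along \<open>ex\<close>, the character becomes a continuous homomorphism on
  the Lie algebra, hence comes from a linear functional. That functional is integral on the kernel
  of \<open>ex\<close> because the character is 1 there.\<close>

lemma group_character_weight:
  assumes c: "group_character G X c"
  obtains \<alpha> where "\<alpha> \<in> weight_lattice G ex" "\<And>g. g \<in> carrier G \<Longrightarrow> c g = weight_char ex \<alpha> g"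
proof -
  have hom: "c g \<in> sphere 0 1" "c (g \<otimes> h) = c g * c h" if "g \<in> carrier G" "h \<in> carrier G" for g h
    using c that by (auto simp: group_character_def hom_def circle_group_def)
  have "continuous_map euclidean euclidean (c \<circ> ex)"
    using c exp_quotient
    by (meson continuous_map_compose group_character_def quotient_imp_continuous_map)
  then have "continuous_on UNIV (\<lambda>x. c (ex x))" by (simp add: o_def)
  moreover have "c (ex (x + y)) = c (ex x) * c (ex y)" for x y
    unfolding exp_add by (rule hom(2)[OF ex_closed ex_closed])
  moreover have "norm (c (ex x)) = 1" for x
    using hom(1)[OF ex_closed ex_closed] by simp
  ultimately obtain \<alpha> :: "'v \<Rightarrow>\<^sub>L real" where
    \<alpha>: "c (ex x) = exp (2 * of_real pi * \<i> * of_real (blinfun_apply \<alpha> x))" for x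
    by (rule continuous_hom_circle_exp) blast
  have "c \<one> = 1" using \<alpha>[of 0] by (simp add: ex_0)
  have "blinfun_apply \<alpha> v \<in> \<int>" if "ex v = \<one>" for v
  proof -
    have "exp (2 * of_real pi * \<i> * of_real (blinfun_apply \<alpha> v)) = c (ex v)"
      by (rule \<alpha>[symmetric])
    also have "\<dots> = 1" by (simp only: that \<open>c \<one> = 1\<close>)
    finally show ?thesis by (simp only: exp_two_pi_Ints)
  qed
  then have w: "\<alpha> \<in> weight_lattice G ex"
    by (simp add: weight_lattice_def integral_lattice_def)
  show ?thesis
    by (rule that[OF w]) (metis \<alpha> weight_char_exp[OF w] ex_inv_into)
qed

text \<open>The extension of \<open>f\<close> to complex arguments is built from multiplicities
  selected by \<open>SOME\<close>. Exhibiting one admissible choice transfers the defining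
  properties to the selected one.\<close>

lemma weight_multiplicities:
  fixes f :: "'g \<Rightarrow> complex"
  assumes "f \<in> character_ring G X"
  defines "m \<equiv> weight_multiplicities G ex f"
  shows "finite {\<alpha>. m \<alpha> \<noteq> 0}" "{\<alpha>. m \<alpha> \<noteq> 0} \<subseteq> weight_lattice G ex"
proof -
  let ?P = "\<lambda>m. finite {\<alpha>. m \<alpha> \<noteq> 0} \<and> {\<alpha>. m \<alpha> \<noteq> 0} \<subseteq> weight_lattice G ex \<and>
       (\<forall>g\<in>carrier G. f g = (\<Sum>\<alpha> | m \<alpha> \<noteq> 0. of_int (m \<alpha>) * weight_char ex \<alpha> g))"
  obtain S n where S: "finite S" "\<And>c. c \<in> S \<Longrightarrow> group_character G X c"
    and f: "\<And>g. g \<in> carrier G \<Longrightarrow> f g = (\<Sum>c\<in>S. of_int (n c) * c g)"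
    using assms(1) unfolding character_ring_def by blast
  have "\<exists>\<alpha>. \<alpha> \<in> weight_lattice G ex \<and> (\<forall>g\<in>carrier G. c g = weight_char ex \<alpha> g)" if "c \<in> S" for c
    using group_character_weight[OF S(2)[OF that]] by metis
  then obtain w where w: "\<And>c. c \<in> S \<Longrightarrow> w c \<in> weight_lattice G ex"
    "\<And>c g. c \<in> S \<Longrightarrow> g \<in> carrier G \<Longrightarrow> c g = weight_char ex (w c) g" by metis
  \<comment> \<open>Functions in \<open>S\<close> may agree on \<open>carrier G\<close> and differ
    elsewhere, so \<open>w\<close> need not be injective; coefficients are summed over its
    fibres.\<close>
  define k where "k \<alpha> = (\<Sum>c | c \<in> S \<and> w c = \<alpha>. n c)" for \<alpha>
  have sub: "{\<alpha>. k \<alpha> \<noteq> 0} \<subseteq> w ` S"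
    unfolding k_def by (force dest: sum.not_neutral_contains_not_neutral)
  have "f g = (\<Sum>\<alpha> | k \<alpha> \<noteq> 0. of_int (k \<alpha>) * weight_char ex \<alpha> g)" if "g \<in> carrier G" for g
  proof -
    have "f g = (\<Sum>c\<in>S. of_int (n c) * weight_char ex (w c) g)"
      using f[OF that] w(2)[OF _ that] by (simp cong: sum.cong)
    also have "\<dots> = (\<Sum>\<alpha>\<in>w ` S. \<Sum>c | c \<in> S \<and> w c = \<alpha>. of_int (n c) * weight_char ex (w c) g)"
      by (rule sum.image_gen[OF S(1)])
    also have "\<dots> = (\<Sum>\<alpha>\<in>w ` S. of_int (k \<alpha>) * weight_char ex \<alpha> g)"
      unfolding k_def by (intro sum.cong refl) (simp add: sum_distrib_right)
    also have "\<dots> = (\<Sum>\<alpha> | k \<alpha> \<noteq> 0. of_int (k \<alpha>) * weight_char ex \<alpha> g)"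
      using sub S(1) by (intro sum.mono_neutral_right) auto
    finally show ?thesis .
  qed
  then have "?P k" using sub S(1) w(1) by (auto intro: finite_subset)
  then have "?P m" unfolding m_def weight_multiplicities_def by (rule someI[where P = ?P])
  then show "finite {\<alpha>. m \<alpha> \<noteq> 0}" "{\<alpha>. m \<alpha> \<noteq> 0} \<subseteq> weight_lattice G ex" by auto
qed

text \<open>Transported to the unit circle by the inverse of \<open>\<phi>\<close>, the
  one-parameter group of \<open>\<xi>\<close> is s to exp(2 pi i a s) for a real constant a. It is
  onto as soon as a is nonzero.\<close>

lemma circle_subgroup_eq_exp_line:
  assumes T: "circle_subgroup G X T" and gen: "infinitesimal_generator G ex T \<xi>" and t: "t \<in> T"
  obtains s where "t = ex (s *\<^sub>R \<xi>)"
proof -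
  have sub: "subgroup T G" using T by (simp add: circle_subgroup_def)
  obtain \<phi> where \<phi>: "\<phi> \<in> iso circle_group (G\<lparr>carrier := T\<rparr>)"
    "homeomorphic_map (top_of_set (sphere 0 1)) (subtopology X T) \<phi>"
    using T unfolding circle_subgroup_def by blast
  obtain \<psi> where \<psi>: "homeomorphic_maps (top_of_set (sphere 0 1)) (subtopology X T) \<phi> \<psi>"
    using \<phi>(2) homeomorphic_map_maps by blast
  have TG: "T \<subseteq> carrier G" using sub by (rule subgroup.subset)
  have top: "topspace (subtopology X T) = T" using TG topspace_eq by auto
  have \<phi>T: "\<phi> a \<in> T" "\<psi> (\<phi> a) = a" if "norm a = 1" for a
    using \<psi> that top unfolding homeomorphic_maps_def continuous_map_def by auto
  have \<psi>T: "norm (\<psi> b) = 1" "\<phi> (\<psi> b) = b" if "b \<in> T" for b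
    using \<psi> that top unfolding homeomorphic_maps_def continuous_map_def by auto
  have \<phi>mult: "\<phi> (a * b) = \<phi> a \<otimes> \<phi> b" if "norm a = 1" "norm b = 1" for a b
    using \<phi>(1) that by (auto simp: iso_def hom_def circle_group_def)
  have \<psi>mult: "\<psi> (a \<otimes> b) = \<psi> a * \<psi> b" if "a \<in> T" "b \<in> T" for a b
    using \<phi>mult[of "\<psi> a" "\<psi> b"] \<psi>T that \<phi>T(2)[of "\<psi> a * \<psi> b"] by (simp add: norm_mult)
  have \<xi>: "\<xi> \<noteq> 0" "integral_lattice G ex \<inter> lie_subalgebra ex T = range (\<lambda>k::int. of_int k *\<^sub>R \<xi>)"
    using gen by (auto simp: infinitesimal_generator_def)
  have "\<xi> \<in> range (\<lambda>k::int. of_int k *\<^sub>R \<xi>)" by (rule image_eqI[of _ _ 1]) auto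
  then have lie: "\<xi> \<in> lie_subalgebra ex T" using \<xi>(2) by blast
  then have exT: "ex (s *\<^sub>R \<xi>) \<in> T" for s by (simp add: lie_subalgebra_def)
  define h where "h s = \<psi> (ex (s *\<^sub>R \<xi>))" for s :: real
  have "continuous_map euclidean (subtopology X T) (\<lambda>s. ex (s *\<^sub>R \<xi>))"
  proof -
    have "continuous_map euclidean X (ex \<circ> (\<lambda>s. s *\<^sub>R \<xi>))"
      by (rule continuous_map_compose[OF _ quotient_imp_continuous_map[OF exp_quotient]])
         (auto intro!: continuous_intros)
    then show ?thesis using exT by (auto simp: continuous_map_in_subtopology o_def)
  qed
  from continuous_map_compose[OF this, of "top_of_set (sphere 0 1)" \<psi>]
  have "continuous_map euclidean (top_of_set (sphere 0 1)) h"
    using \<psi> by (simp add: homeomorphic_maps_def comp_def flip: h_def)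
  then have "continuous_on UNIV h" by (simp add: continuous_map_in_subtopology)
  moreover have "h (s + s') = h s * h s'" for s s'
    unfolding h_def scaleR_add_left exp_add by (rule \<psi>mult[OF exT exT])
  moreover have "norm (h s) = 1" for s
    unfolding h_def by (rule \<psi>T(1)[OF exT])
  ultimately obtain a :: "real \<Rightarrow>\<^sub>L real" where
    a: "h s = exp (2 * of_real pi * \<i> * of_real (blinfun_apply a s))" for s
    by (rule continuous_hom_circle_exp) blast
  have a_eq: "blinfun_apply a s = s * blinfun_apply a 1" for s
    using blinfun.scaleR_right[of a s 1] by simp
  have ex_h: "ex (s *\<^sub>R \<xi>) = \<phi> (h s)" for s using \<psi>T exT by (simp add: h_def)
  \<comment> \<open>Otherwise the line is mapped to the identity, so half of \<open>\<xi>\<close>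
    lies in the lattice whose intersection with the line is generated by
    \<open>\<xi>\<close>.\<close>
  have "blinfun_apply a 1 \<noteq> 0"
  proof
    assume "blinfun_apply a 1 = 0"
    then have "h (1/2) = h 0"
      using a[of "1/2"] a[of 0] a_eq[of "1/2"] a_eq[of 0] by simp
    then have "(1/2) *\<^sub>R \<xi> \<in> integral_lattice G ex"
      using ex_h ex_0 by (simp add: integral_lattice_def) (metis scaleR_zero_left)
    moreover have "(1/2) *\<^sub>R \<xi> \<in> lie_subalgebra ex T"
      using exT by (simp add: lie_subalgebra_def)
    ultimately have "(1/2) *\<^sub>R \<xi> \<in> range (\<lambda>k::int. of_int k *\<^sub>R \<xi>)" using \<xi>(2) by blast
    then obtain k :: int where "(1/2) *\<^sub>R \<xi> = of_int k *\<^sub>R \<xi>" by blast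
    then have "(1/2::real) = of_int k" using \<xi>(1) by (simp only: scaleR_cancel_right) simp
    then have "real_of_int (2 * k) = 1" by simp
    then have "2 * k = 1" by linarith
    then show False by presburger
  qed
  moreover obtain \<theta> where \<theta>: "\<psi> t = exp (\<i> * of_real \<theta>)"
    using \<psi>T(1)[OF t] complex_unimodular_polar by (metis cis_conv_exp cis.code)
  \<comment> \<open>The parameter solves 2 pi a s = \<open>\<theta>\<close>, with a the value of the
    functional at 1.\<close>
  ultimately have "h (\<theta> / (2 * pi * blinfun_apply a 1)) = \<psi> t"
    by (subst a, subst a_eq) (simp add: field_simps)
  then have "ex ((\<theta> / (2 * pi * blinfun_apply a 1)) *\<^sub>R \<xi>) = t"
    using ex_h \<psi>T(2)[OF t] by simp
  then show ?thesis using that by metis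
qed

lemma generator_in_lattice:
  assumes "infinitesimal_generator G ex T \<xi>"
  shows "\<xi> \<in> integral_lattice G ex"
proof -
  have "\<xi> \<in> range (\<lambda>k::int. of_int k *\<^sub>R \<xi>)" by (rule image_eqI[of _ _ 1]) auto
  with assms show ?thesis unfolding infinitesimal_generator_def by blast
qed

text \<open>Every element of \<open>T\<close> is the exponential of a multiple of
  \<open>\<xi>\<close>. This serves twice: such characters factor through the quotient, and an edge
  weight vanishing on \<open>\<xi>\<close> would put \<open>T\<close> inside the edge
  kernel.\<close>

lemma weight_char_trivial_on_circle:
  assumes "circle_subgroup G X T" "infinitesimal_generator G ex T \<xi>"
    and "\<alpha> \<in> weight_lattice G ex" "blinfun_apply \<alpha> \<xi> = 0" "t \<in> T"
  shows "weight_char ex \<alpha> t = 1"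
proof -
  obtain s where "t = ex (s *\<^sub>R \<xi>)"
    using circle_subgroup_eq_exp_line[OF assms(1,2,5)] .
  then show ?thesis using assms(4) by (simp add: weight_char_exp[OF assms(3)] blinfun.scaleR_right)
qed

lemma weight_char_descends:
  assumes T: "circle_subgroup G X T" "infinitesimal_generator G ex T \<xi>"
    and \<gamma>: "\<gamma> \<in> weight_lattice G ex" "blinfun_apply \<gamma> \<xi> = 0"
  shows "descends G X T (weight_char ex \<gamma>)"
proof -
  have sub: "subgroup T G" using T by (simp add: circle_subgroup_def)
  then interpret normal T G by (rule subgroup_imp_normal)
  \<comment> \<open>An arbitrary representative may be used: any two differ by an element of
    \<open>T\<close>, where the character is 1.\<close>
  define c where "c C = weight_char ex \<gamma> (SOME g. g \<in> C)" for C :: "'g set"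
  have c: "c (T #> g) = weight_char ex \<gamma> g" if g: "g \<in> carrier G" for g
  proof -
    have "(SOME h. h \<in> T #> g) \<in> T #> g" using rcos_self[OF g sub] by (rule someI)
    then obtain t where t: "t \<in> T" "(SOME h. h \<in> T #> g) = t \<otimes> g" by (auto simp: r_coset_def)
    then have "t \<in> carrier G" using subset by blast
    with t g show ?thesis
      using weight_char_trivial_on_circle[OF T \<gamma>] by (simp add: c_def weight_char_mult[OF \<gamma>(1)])
  qed
  have "group_character (G Mod T) (quotient_group_topology G X T) c"
    unfolding group_character_def
  proof
    show "c \<in> hom (G Mod T) circle_group"
      by (auto simp: hom_def FactGroup_def RCOSETS_def circle_group_def c norm_weight_char
          rcos_sum weight_char_mult[OF \<gamma>(1)])
    show "continuous_map (quotient_group_topology G X T) euclidean c"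
    proof (rule continuous_compose_quotient_map[OF quotient_map_coset[OF topspace_eq]])
      show "continuous_map X euclidean (c \<circ> (#>) T)"
        by (rule continuous_map_eq[OF continuous_weight_char[OF \<gamma>(1)]]) (simp add: c topspace_eq)
    qed
  qed
  from character_ring_character[OF this] show ?thesis
    unfolding descends_def using c by blast
qed

end

section \<open>Means of quotients of characters\<close>

lemma norm_ext_char: "norm (ext_char ex \<xi> \<alpha> g z) = norm z powi \<lfloor>blinfun_apply \<alpha> \<xi>\<rfloor>"
  by (simp add: ext_char_def norm_mult norm_weight_char norm_power_int)

text \<open>Off the unit circle the modulus of the extended character is a nonzero power of a number
  other than 1. Hence the poles of the quotients lie on the unit circle.\<close>

lemma ext_char_neq_1:
  assumes "norm z > 0" "norm z \<noteq> 1" "\<lfloor>blinfun_apply \<alpha> \<xi>\<rfloor> \<noteq> 0"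
  shows "ext_char ex \<xi> \<alpha> g z \<noteq> 1"
proof
  assume "ext_char ex \<xi> \<alpha> g z = 1"
  then have "norm z powi \<lfloor>blinfun_apply \<alpha> \<xi>\<rfloor> = 1"
    using norm_ext_char[of ex \<xi> \<alpha> g z] by simp
  then have "norm z powr of_int \<lfloor>blinfun_apply \<alpha> \<xi>\<rfloor> = 1"
    using assms(1) by (simp add: powr_real_of_int')
  then show False using assms by (simp add: powr_def)
qed

lemma continuous_on_ext_char_quotient:
  assumes "r > 0" "r \<noteq> 1" "\<And>e. e \<in> S \<Longrightarrow> \<lfloor>blinfun_apply (\<alpha> e) \<xi>\<rfloor> \<noteq> 0"
  shows "continuous_on (sphere 0 r)
    (\<lambda>z. ext_char ex \<xi> \<beta> g z * (\<Prod>e\<in>S. inverse (1 - ext_char ex \<xi> (\<alpha> e) g z)))"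
proof -
  have "continuous_on (sphere 0 r) (\<lambda>z. ext_char ex \<xi> \<gamma> g z)" for \<gamma>
    unfolding ext_char_def using assms(1) by (intro continuous_intros) auto
  moreover have "1 - ext_char ex \<xi> (\<alpha> e) g z \<noteq> 0" if "e \<in> S" "z \<in> sphere 0 r" for e z
    using ext_char_neq_1[of z "\<alpha> e" \<xi> ex g] assms that by auto
  ultimately show ?thesis by (intro continuous_intros) auto
qed

section \<open>Reduction of the circle means to characters trivial on \<open>T\<close>\<close>

context torus
begin

lemma floor_weight:
  assumes "\<alpha> \<in> weight_lattice G ex" "\<xi> \<in> integral_lattice G ex"
  shows "of_int \<lfloor>blinfun_apply \<alpha> \<xi>\<rfloor> = blinfun_apply \<alpha> \<xi>"
  using assms by (auto simp: weight_lattice_def)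

lemma ext_char_add:
  assumes "\<alpha> \<in> weight_lattice G ex" "\<beta> \<in> weight_lattice G ex" "\<xi> \<in> integral_lattice G ex" "z \<noteq> 0"
  shows "ext_char ex \<xi> (\<alpha> + \<beta>) g z = ext_char ex \<xi> \<alpha> g z * ext_char ex \<xi> \<beta> g z"
proof -
  have "\<lfloor>blinfun_apply (\<alpha> + \<beta>) \<xi>\<rfloor> = \<lfloor>blinfun_apply \<alpha> \<xi>\<rfloor> + \<lfloor>blinfun_apply \<beta> \<xi>\<rfloor>"
    using assms by (auto simp: weight_lattice_def blinfun.add_left)
  with assms(4) show ?thesis by (simp add: ext_char_def weight_char_add power_int_add)
qed

lemma ext_char_minus:
  assumes "\<alpha> \<in> weight_lattice G ex" "\<xi> \<in> integral_lattice G ex"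
  shows "ext_char ex \<xi> (- \<alpha>) g z = inverse (ext_char ex \<xi> \<alpha> g z)"
proof -
  have "\<lfloor>blinfun_apply (- \<alpha>) \<xi>\<rfloor> = - \<lfloor>blinfun_apply \<alpha> \<xi>\<rfloor>"
    using assms by (auto simp: weight_lattice_def blinfun.minus_left elim!: Ints_cases)
  then show ?thesis by (simp add: ext_char_def weight_char_minus power_int_minus)
qed

lemma ext_char_minus_generator:
  assumes "\<alpha> \<in> weight_lattice G ex" "\<xi> \<in> integral_lattice G ex"
  shows "ext_char ex \<xi> \<alpha> g (inverse w) = ext_char ex (- \<xi>) \<alpha> g w"
proof -
  have "\<lfloor>blinfun_apply \<alpha> (- \<xi>)\<rfloor> = - \<lfloor>blinfun_apply \<alpha> \<xi>\<rfloor>"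
    using assms by (auto simp: weight_lattice_def blinfun.minus_right elim!: Ints_cases)
  then show ?thesis by (simp add: ext_char_def power_int_minus power_int_inverse)
qed

lemma ext_char_0: "ext_char ex \<xi> 0 g z = 1"
  by (simp add: ext_char_def weight_char_def)

lemma ext_char_sum:
  assumes "finite S" "\<And>s. s \<in> S \<Longrightarrow> \<alpha> s \<in> weight_lattice G ex" "\<xi> \<in> integral_lattice G ex" "z \<noteq> 0"
  shows "ext_char ex \<xi> (\<Sum>s\<in>S. \<alpha> s) g z = (\<Prod>s\<in>S. ext_char ex \<xi> (\<alpha> s) g z)"
  using assms(1,2)
  by (induction S) (simp_all add: ext_char_0 ext_char_add weight_lattice_sum assms(3,4))

text \<open>A double induction: the outer one removes factors of the product, the inner one raises
  the exponent of \<open>z\<close> in the numerator. Descent of single characters enters as a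
  hypothesis, so that the result serves both \<open>\<xi>\<close> and
  \<open>- \<xi>\<close>.\<close>

lemma descends_circle_mean_positive:
  assumes \<xi>: "\<xi> \<in> integral_lattice G ex"
    and desc: "\<And>\<gamma>. \<gamma> \<in> weight_lattice G ex \<Longrightarrow> blinfun_apply \<gamma> \<xi> = 0 \<Longrightarrow>
      descends G X T (weight_char ex \<gamma>)"
    and r: "0 < r" "r < 1"
    and "finite S" "\<And>e. e \<in> S \<Longrightarrow> \<alpha> e \<in> weight_lattice G ex"
      "\<And>e. e \<in> S \<Longrightarrow> blinfun_apply (\<alpha> e) \<xi> > 0"
    and "\<beta> \<in> weight_lattice G ex"
  shows "descends G X T (\<lambda>g. circle_mean r (\<lambda>z. ext_char ex \<xi> \<beta> g z *
    (\<Prod>e\<in>S. inverse (1 - ext_char ex \<xi> (\<alpha> e) g z))))"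
  using assms(5-8)
proof (induction S arbitrary: \<beta>)
  case empty
  \<comment> \<open>Without denominators the mean extracts the constant term in \<open>z\<close>,
    which is present only when \<open>\<beta>\<close> vanishes on \<open>\<xi>\<close>.\<close>
  define k where "k = \<lfloor>blinfun_apply \<beta> \<xi>\<rfloor>"
  have "circle_mean r (\<lambda>z. ext_char ex \<xi> \<beta> g z) = (if k = 0 then weight_char ex \<beta> g else 0)" for g
    using circle_mean_cmult[of r "weight_char ex \<beta> g" "\<lambda>z. z powi k"] circle_mean_powi[OF r(1), of k]
    by (simp add: ext_char_def k_def)
  moreover have "blinfun_apply \<beta> \<xi> = 0" if "k = 0"
    using floor_weight[OF empty(3) \<xi>, folded k_def] that by simp
  ultimately show ?case
    using empty(3) desc by (cases "k = 0") (simp_all add: descends_zero)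
next
  case (insert e S)
  define I where "I \<beta> g = circle_mean r (\<lambda>z. ext_char ex \<xi> \<beta> g z *
    (\<Prod>e\<in>insert e S. inverse (1 - ext_char ex \<xi> (\<alpha> e) g z)))" for \<beta> g
  have \<alpha>: "\<alpha> e' \<in> weight_lattice G ex" "\<lfloor>blinfun_apply (\<alpha> e') \<xi>\<rfloor> > 0" if "e' \<in> insert e S" for e'
    using insert.prems(1,2)[OF that] floor_weight[OF _ \<xi>, of "\<alpha> e'"]
    by (simp, metis of_int_0_less_iff)
  have "descends G X T (I \<beta>)"
    using insert.prems(3)
  \<comment> \<open>The measure is 0 exactly for positive exponents. The 1 matters: exponent 0 has
    measure 1, so one further step is still a descent.\<close>
  proof (induction "nat (1 - \<lfloor>blinfun_apply \<beta> \<xi>\<rfloor>)" arbitrary: \<beta> rule: less_induct)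
    case (less \<beta>)
    define k where "k = \<lfloor>blinfun_apply \<beta> \<xi>\<rfloor>"
    show ?case
    proof (cases "k > 0")
      case True
      have "I \<beta> = (\<lambda>_. 0)"
      proof
        fix g
        \<comment> \<open>The integrand divided by \<open>z\<close>. All exponents are nonnegative
          here, and natural powers make the formula holomorphic at 0 too.\<close>
        define h where "h z = weight_char ex \<beta> g * z ^ nat (k - 1) * (\<Prod>e\<in>insert e S.
          inverse (1 - weight_char ex (\<alpha> e) g * z ^ nat \<lfloor>blinfun_apply (\<alpha> e) \<xi>\<rfloor>))" for z
        have "I \<beta> g = circle_mean r (\<lambda>z. z * h z)"
          unfolding I_def
        proof (rule circle_mean_cong)
          fix z :: complex assume "norm z = r"
          have "z powi k = z * z ^ nat (k - 1)"
            using True by (simp add: power_int_def Suc_nat_eq_nat_zadd1 flip: power_Suc)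
          moreover
          have "z powi \<lfloor>blinfun_apply (\<alpha> e') \<xi>\<rfloor> = z ^ nat \<lfloor>blinfun_apply (\<alpha> e') \<xi>\<rfloor>"
            if "e' \<in> insert e S" for e'
            using \<alpha>(2)[OF that] by (simp add: power_int_def)
          then have "(\<Prod>e\<in>insert e S. inverse (1 - ext_char ex \<xi> (\<alpha> e) g z)) =
              (\<Prod>e\<in>insert e S.
                inverse (1 - weight_char ex (\<alpha> e) g * z ^ nat \<lfloor>blinfun_apply (\<alpha> e) \<xi>\<rfloor>))"
            unfolding ext_char_def by (intro prod.cong refl) metis
          ultimately show "ext_char ex \<xi> \<beta> g z *
              (\<Prod>e\<in>insert e S. inverse (1 - ext_char ex \<xi> (\<alpha> e) g z)) = z * h z"
            by (simp only: h_def) (simp add: ext_char_def flip: k_def)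
        qed (use r in simp)
        also have "\<dots> = 0"
        proof (rule circle_mean_holomorphic[of _ 1])
          have "1 - weight_char ex (\<alpha> e') g * z ^ nat \<lfloor>blinfun_apply (\<alpha> e') \<xi>\<rfloor> \<noteq> 0"
            if "e' \<in> insert e S" "z \<in> ball 0 1" for e' z
          proof
            assume "1 - weight_char ex (\<alpha> e') g * z ^ nat \<lfloor>blinfun_apply (\<alpha> e') \<xi>\<rfloor> = 0"
            then have "norm (weight_char ex (\<alpha> e') g * z ^ nat \<lfloor>blinfun_apply (\<alpha> e') \<xi>\<rfloor>) = 1"
              by (metis eq_iff_diff_eq_0 norm_one)
            moreover have "norm z ^ nat \<lfloor>blinfun_apply (\<alpha> e') \<xi>\<rfloor> < 1"
              using that(2) \<alpha>(2)[OF that(1)] by (intro power_less_one_iff[THEN iffD2]) auto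
            ultimately show False by (simp add: norm_mult norm_power norm_weight_char)
          qed
          then show "h holomorphic_on ball 0 1"
            unfolding h_def by (intro holomorphic_intros) auto
        qed (use r in auto)
        finally show "I \<beta> g = 0" .
      qed
      then show ?thesis by (simp add: descends_zero)
    next
      case False
      define P where "P g z = (\<Prod>e\<in>S. inverse (1 - ext_char ex \<xi> (\<alpha> e) g z))" for g z
      have fl: "\<lfloor>blinfun_apply (\<beta> + \<alpha> e) \<xi>\<rfloor> = k + \<lfloor>blinfun_apply (\<alpha> e) \<xi>\<rfloor>"
        using less.prems \<alpha>(1)[of e] \<xi> by (auto simp: weight_lattice_def blinfun.add_left k_def)
      have "descends G X T (I (\<beta> + \<alpha> e))"
        using False \<alpha>[of e] less.prems
        by (intro less.hyps weight_lattice_add) (auto simp: fl simp flip: k_def)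
      moreover have "descends G X T (\<lambda>g. circle_mean r (\<lambda>z. ext_char ex \<xi> \<beta> g z * P g z))"
        unfolding P_def using insert.prems less.prems by (intro insert.IH) auto
      \<comment> \<open>Expanding the factor of \<open>e\<close> once: the summand 1 drops this
        factor, the other summand shifts \<open>\<beta>\<close> by
        \<open>\<alpha> e\<close>.\<close>
      moreover have "I \<beta> g = circle_mean r (\<lambda>z. ext_char ex \<xi> \<beta> g z * P g z) + I (\<beta> + \<alpha> e) g" for g
      proof -
        have "I \<beta> g = circle_mean r (\<lambda>z. ext_char ex \<xi> \<beta> g z * P g z +
          ext_char ex \<xi> (\<beta> + \<alpha> e) g z *
            (\<Prod>e\<in>insert e S. inverse (1 - ext_char ex \<xi> (\<alpha> e) g z)))"
          unfolding I_def
        proof (rule circle_mean_cong)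
          fix z :: complex assume z: "norm z = r"
          define w where "w = ext_char ex \<xi> (\<alpha> e) g z"
          have "w \<noteq> 1"
            unfolding w_def using z r less_imp_neq[OF \<alpha>(2)[of e]] by (intro ext_char_neq_1) auto
          then have "inverse (1 - w) = 1 + w * inverse (1 - w)" by (simp add: field_simps)
          moreover have "ext_char ex \<xi> (\<beta> + \<alpha> e) g z = ext_char ex \<xi> \<beta> g z * w"
            unfolding w_def using z r by (intro ext_char_add less.prems \<alpha> \<xi>) auto
          moreover have "(\<Prod>e\<in>insert e S. inverse (1 - ext_char ex \<xi> (\<alpha> e) g z)) =
              inverse (1 - w) * P g z"
            using insert.hyps by (simp add: P_def w_def)
          ultimately show "ext_char ex \<xi> \<beta> g z *
              (\<Prod>e\<in>insert e S. inverse (1 - ext_char ex \<xi> (\<alpha> e) g z)) =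
            ext_char ex \<xi> \<beta> g z * P g z + ext_char ex \<xi> (\<beta> + \<alpha> e) g z *
              (\<Prod>e\<in>insert e S. inverse (1 - ext_char ex \<xi> (\<alpha> e) g z))"
            by (metis (no_types, lifting) distrib_left distrib_right mult.assoc mult_1)
        qed (use r in simp)
        also have "\<dots> = circle_mean r (\<lambda>z. ext_char ex \<xi> \<beta> g z * P g z) + I (\<beta> + \<alpha> e) g"
          unfolding I_def P_def using r \<alpha>(2)
          by (intro circle_mean_add continuous_on_ext_char_quotient) fastforce+
        finally show ?thesis .
      qed
      ultimately show ?thesis
        using descends_add by (metis (no_types, lifting) descends_cong)
    qed
  qed
  then show ?case unfolding I_def .
qed

text \<open>
  The identity \<open>1 / (1 - w) = - (1 / w) / (1 - 1 / w)\<close> replaces every weight that is negative on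
  \<open>\<xi>\<close> by its opposite.
\<close>

lemma descends_circle_mean:
  assumes \<xi>: "\<xi> \<in> integral_lattice G ex"
    and desc: "\<And>\<gamma>. \<gamma> \<in> weight_lattice G ex \<Longrightarrow> blinfun_apply \<gamma> \<xi> = 0 \<Longrightarrow>
      descends G X T (weight_char ex \<gamma>)"
    and r: "0 < r" "r < 1"
    and S: "finite S" "\<And>e. e \<in> S \<Longrightarrow> \<alpha> e \<in> weight_lattice G ex"
      "\<And>e. e \<in> S \<Longrightarrow> blinfun_apply (\<alpha> e) \<xi> \<noteq> 0"
    and \<beta>: "\<beta> \<in> weight_lattice G ex"
  shows "descends G X T (\<lambda>g. circle_mean r (\<lambda>z. ext_char ex \<xi> \<beta> g z *
    (\<Prod>e\<in>S. inverse (1 - ext_char ex \<xi> (\<alpha> e) g z))))"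
proof -
  define neg where "neg e \<longleftrightarrow> blinfun_apply (\<alpha> e) \<xi> < 0" for e
  define \<alpha>' where "\<alpha>' e = (if neg e then - \<alpha> e else \<alpha> e)" for e
  \<comment> \<open>For a flipped weight, \<open>\<delta>\<close> records the numerator 1 / w and
    \<open>\<sigma>\<close> the sign; other weights contribute the trivial weight and 1.\<close>
  define \<delta> where "\<delta> e = (if neg e then - \<alpha> e else 0)" for e
  define \<sigma> :: "_ \<Rightarrow> int" where "\<sigma> e = (if neg e then - 1 else 1)" for e
  have \<alpha>': "\<alpha>' e \<in> weight_lattice G ex" "blinfun_apply (\<alpha>' e) \<xi> > 0" if "e \<in> S" for e
    using S(2,3)[OF that] by (auto simp: \<alpha>'_def neg_def weight_lattice_minus blinfun.minus_left)
  have \<delta>: "\<delta> e \<in> weight_lattice G ex" if "e \<in> S" for e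
    using S(2)[OF that] by (auto simp: \<delta>_def weight_lattice_minus, simp add: weight_lattice_def)
  have \<beta>': "\<beta> + (\<Sum>e\<in>S. \<delta> e) \<in> weight_lattice G ex"
    using \<beta> \<delta> by (intro weight_lattice_add weight_lattice_sum)
  have "circle_mean r (\<lambda>z. ext_char ex \<xi> \<beta> g z *
      (\<Prod>e\<in>S. inverse (1 - ext_char ex \<xi> (\<alpha> e) g z))) =
    of_int (\<Prod>e\<in>S. \<sigma> e) * circle_mean r (\<lambda>z. ext_char ex \<xi> (\<beta> + (\<Sum>e\<in>S. \<delta> e)) g z *
      (\<Prod>e\<in>S. inverse (1 - ext_char ex \<xi> (\<alpha>' e) g z)))" for g
  proof (subst circle_mean_cmult[symmetric], rule circle_mean_cong)
    fix z :: complex assume z: "norm z = r"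
    then have z0: "z \<noteq> 0" using r by auto
    have "inverse (1 - ext_char ex \<xi> (\<alpha> e) g z) =
      of_int (\<sigma> e) * ext_char ex \<xi> (\<delta> e) g z * inverse (1 - ext_char ex \<xi> (\<alpha>' e) g z)"
      if e: "e \<in> S" for e
    proof (cases "neg e")
      case True
      define w where "w = ext_char ex \<xi> (\<alpha> e) g z"
      have "\<lfloor>blinfun_apply (\<alpha> e) \<xi>\<rfloor> \<noteq> 0"
        using S(3)[OF e] floor_weight[OF S(2)[OF e] \<xi>] by auto
      then have "w \<noteq> 1" unfolding w_def using z r by (intro ext_char_neq_1) auto
      moreover have "w \<noteq> 0"
        using norm_ext_char[of ex \<xi> "\<alpha> e" g z] z r by (auto simp: w_def)
      ultimately have "inverse (1 - w) = - inverse w * inverse (1 - inverse w)"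
        by (simp add: field_simps)
      with True show ?thesis
        by (simp add: \<alpha>'_def \<delta>_def \<sigma>_def ext_char_minus[OF S(2)[OF e] \<xi>] w_def)
    qed (simp add: \<alpha>'_def \<delta>_def \<sigma>_def ext_char_0)
    then have "(\<Prod>e\<in>S. inverse (1 - ext_char ex \<xi> (\<alpha> e) g z)) =
        of_int (\<Prod>e\<in>S. \<sigma> e) * ext_char ex \<xi> (\<Sum>e\<in>S. \<delta> e) g z *
        (\<Prod>e\<in>S. inverse (1 - ext_char ex \<xi> (\<alpha>' e) g z))"
      using z0 by (simp add: ext_char_sum[OF S(1) \<delta> \<xi>] of_int_prod prod.distrib cong: prod.cong)
    moreover have "ext_char ex \<xi> (\<beta> + (\<Sum>e\<in>S. \<delta> e)) g z =
        ext_char ex \<xi> \<beta> g z * ext_char ex \<xi> (\<Sum>e\<in>S. \<delta> e) g z"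
      using z r \<delta> by (intro ext_char_add \<beta> \<xi> weight_lattice_sum) auto
    ultimately show "ext_char ex \<xi> \<beta> g z * (\<Prod>e\<in>S. inverse (1 - ext_char ex \<xi> (\<alpha> e) g z)) =
      of_int (\<Prod>e\<in>S. \<sigma> e) * (ext_char ex \<xi> (\<beta> + (\<Sum>e\<in>S. \<delta> e)) g z *
      (\<Prod>e\<in>S. inverse (1 - ext_char ex \<xi> (\<alpha>' e) g z)))"
      by (simp only: mult_ac)
  qed (use r in simp)
  then show ?thesis
    using descends_cmult[OF descends_circle_mean_positive[where \<alpha> = \<alpha>' and S = S, OF \<xi> desc r S(1) \<alpha>' \<beta>']]
    by (simp del: of_int_prod)
qed

text \<open>Covers both circles at once. A radius above 1 becomes \<open>1 / r\<close> with
  generator \<open>- \<xi>\<close>, and the descent hypothesis survives because a weight vanishes on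
  \<open>\<xi>\<close> iff it vanishes on \<open>- \<xi>\<close>. Linearity in the numerator then
  handles the sum.\<close>

lemma descends_circle_mean_sum:
  assumes \<xi>: "\<xi> \<in> integral_lattice G ex"
    and desc: "\<And>\<gamma>. \<gamma> \<in> weight_lattice G ex \<Longrightarrow> blinfun_apply \<gamma> \<xi> = 0 \<Longrightarrow>
      descends G X T (weight_char ex \<gamma>)"
    and r: "0 < r" "r \<noteq> 1"
    and S: "finite S" "\<And>e. e \<in> S \<Longrightarrow> \<alpha> e \<in> weight_lattice G ex"
      "\<And>e. e \<in> S \<Longrightarrow> blinfun_apply (\<alpha> e) \<xi> \<noteq> 0"
    and B: "finite B" "B \<subseteq> weight_lattice G ex"
  shows "descends G X T (\<lambda>g. circle_mean r (\<lambda>z. (\<Sum>\<beta>\<in>B. of_int (m \<beta>) * ext_char ex \<xi> \<beta> g z) *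
    (\<Prod>e\<in>S. inverse (1 - ext_char ex \<xi> (\<alpha> e) g z))))"
proof -
  define I where "I \<beta> g = circle_mean r (\<lambda>z. ext_char ex \<xi> \<beta> g z *
    (\<Prod>e\<in>S. inverse (1 - ext_char ex \<xi> (\<alpha> e) g z)))" for \<beta> g
  have nz: "\<lfloor>blinfun_apply (\<alpha> e) \<xi>\<rfloor> \<noteq> 0" if "e \<in> S" for e
    using S(3)[OF that] floor_weight[OF S(2)[OF that] \<xi>] by auto
  \<comment> \<open>Continuity away from the unit circle justifies both exchanging sum and integral
    and inverting the circle.\<close>
  note cont = continuous_on_ext_char_quotient[where S = S and \<alpha> = \<alpha> and \<xi> = \<xi>, OF r nz]
  have I: "descends G X T (I \<beta>)" if "\<beta> \<in> B" for \<beta>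
  proof (cases "r < 1")
    case True
    then show ?thesis
      unfolding I_def using B(2) that by (intro descends_circle_mean[OF \<xi> desc] r S) auto
  next
    case False
    have \<beta>: "\<beta> \<in> weight_lattice G ex" using B(2) that by blast
    have \<xi>': "- \<xi> \<in> integral_lattice G ex"
      using exp_add[of "- \<xi>" \<xi>] \<xi> r_one[OF ex_closed[of "- \<xi>"]]
      by (simp add: integral_lattice_def ex_0)
    have "I \<beta> g = circle_mean (1 / r) (\<lambda>z. ext_char ex (- \<xi>) \<beta> g z *
        (\<Prod>e\<in>S. inverse (1 - ext_char ex (- \<xi>) (\<alpha> e) g z)))" for g
      unfolding I_def using r S(2)
      by (subst circle_mean_inverse[OF cont])
        (simp_all add: ext_char_minus_generator[OF _ \<xi>] \<beta> cong: prod.cong)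
    moreover have "descends G X T (\<lambda>g. circle_mean (1 / r) (\<lambda>z. ext_char ex (- \<xi>) \<beta> g z *
        (\<Prod>e\<in>S. inverse (1 - ext_char ex (- \<xi>) (\<alpha> e) g z))))"
      using False r by (intro descends_circle_mean \<xi>' desc S \<beta>) (auto simp: blinfun.minus_right S(3))
    ultimately show ?thesis by (simp add: descends_cong)
  qed
  have "circle_mean r (\<lambda>z. (\<Sum>\<beta>\<in>B. of_int (m \<beta>) * ext_char ex \<xi> \<beta> g z) *
      (\<Prod>e\<in>S. inverse (1 - ext_char ex \<xi> (\<alpha> e) g z))) = (\<Sum>\<beta>\<in>B. of_int (m \<beta>) * I \<beta> g)" for g
    unfolding I_def circle_mean_cmult[symmetric] sum_distrib_right mult.assoc
    using r by (intro circle_mean_sum B continuous_on_mult continuous_on_const cont) auto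
  then show ?thesis using descends_sum[OF B(1) descends_cmult[OF I]] by simp
qed

end

section \<open>The residue as a difference of two circle means\<close>

theorem theorem1p6:
  fixes G :: "('g, 'm) monoid_scheme" and X :: "'g topology"
    and ex :: "'v::euclidean_space \<Rightarrow> 'g"
    and \<Gamma> :: "('p, 'e) pre_digraph" and rev :: "'e \<Rightarrow> 'e" and d :: nat
    and \<rho> :: "'e \<Rightarrow> 'g \<Rightarrow> complex mat" and \<tau> :: "'p \<Rightarrow> 'g \<Rightarrow> complex mat"
    and \<alpha> :: "'e \<Rightarrow> 'v \<Rightarrow>\<^sub>L real"
    and T :: "'g set" and \<xi> :: 'v
    and f :: "'p \<Rightarrow> 'g \<Rightarrow> complex" and p :: 'p and R r :: real
  assumes "gkm_action G X ex \<Gamma> rev d \<rho> \<tau> \<alpha>"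
    and "circle_subgroup G X T"
    and "\<forall>e\<in>arcs \<Gamma>. \<not> T \<subseteq> edge_kernel G ex (\<alpha> e)"
    and "infinitesimal_generator G ex T \<xi>"
    and "f \<in> graph_K_ring G X ex \<Gamma> \<alpha>"
    and "p \<in> verts \<Gamma>"
    and "R > 1" and "0 < r" and "r < 1"
  shows "\<exists>\<phi>\<in>character_ring (G Mod T) (quotient_group_topology G X T).
           \<forall>g\<in>carrier G. \<phi> (T #>\<^bsub>G\<^esub> g) = residue_T R r (f_sharp G ex \<Gamma> \<alpha> \<xi> f p) g"
proof -
  interpret gkm_action G X ex \<Gamma> rev d \<rho> \<tau> \<alpha> by (rule assms(1))
  define m where "m = weight_multiplicities G ex (f p)"
  have "f p \<in> character_ring G X" using assms(5,6) by (auto simp: graph_K_ring_def)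
  note m = weight_multiplicities[OF this, folded m_def]
  note \<xi> = generator_in_lattice[OF assms(4)]
  note desc = weight_char_descends[OF assms(2,4)]
  have S: "finite (out_arcs \<Gamma> p)" by (simp add: out_arcs_def)
  have \<alpha>: "\<alpha> e \<in> weight_lattice G ex" if "e \<in> out_arcs \<Gamma> p" for e
    using that by (simp add: edge_weight)
  \<comment> \<open>This is where the assumption that \<open>T\<close> lies in no edge kernel
    enters: every denominator genuinely depends on \<open>z\<close>.\<close>
  have nz: "blinfun_apply (\<alpha> e) \<xi> \<noteq> 0" if e: "e \<in> out_arcs \<Gamma> p" for e
  proof
    assume "blinfun_apply (\<alpha> e) \<xi> = 0"
    then have "T \<subseteq> edge_kernel G ex (\<alpha> e)"
      using weight_char_trivial_on_circle[OF assms(2,4) \<alpha>[OF e]] assms(2)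
      by (auto simp: edge_kernel_def kernel_def circle_group_def circle_subgroup_def
          dest: subgroup.mem_carrier)
    then show False using assms(3) e by auto
  qed
  have F: "descends G X T (\<lambda>g. circle_mean s (f_sharp G ex \<Gamma> \<alpha> \<xi> f p g))" if "s > 0" "s \<noteq> 1" for s
    using descends_circle_mean_sum[OF \<xi> desc that S \<alpha> nz m]
    by (simp add: f_sharp_def[abs_def] ext_fun_def Let_def flip: m_def)
  have "residue_T R r (f_sharp G ex \<Gamma> \<alpha> \<xi> f p) =
      (\<lambda>g. circle_mean R (f_sharp G ex \<Gamma> \<alpha> \<xi> f p g) - circle_mean r (f_sharp G ex \<Gamma> \<alpha> \<xi> f p g))"
    using assms(7,8) by (intro ext) (simp only: residue_T_def contour_integral_eq_circle_mean)
  then show ?thesis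
    using descends_diff[OF F[of R] F[of r]] assms(7-9) by (simp add: descends_def)
qed

end
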